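(* Let $(r_n)_{n\ge1}$ be a sequence of positive real numbers, let $\omega=(\omega_n)_{n\ge1}$ be an i.i.d. sequence of random points uniformly distributed on $\mathbb{T}=\mathbb{R}/\mathbb{Z}$, and let $\mathcal{U}(\omega)=\{y\in\mathbb{T}:\ \exists N_0\ \forall N\ge N_0\ \exists\, 1\le n\le N,\ \|\omega_n-y\|<r_N\}$. If $\sum_{n=1}^\infty nr_n<\infty$, then almost surely $\mathcal{U}(\omega)=\{\omega_k: k\in\mathbb{N}\}$, where $\mathbb{N}=\{1,2,3,\dots\}$.
   Context: $\mathbb{T}=\mathbb{R}/\mathbb{Z}$ is the one-dimensional torus with normalized Lebesgue (uniform) measure, and $\|x\|$ denotes the distance of $x\in\mathbb{T}$ to $0$, i.e. the distance of a real representative of $x$ to the nearest integer. *)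

theory Defs
  imports "HOL-Probability.Probability"
begin

(* The torus R/Z is represented by its fundamental domain {0..<1}: every class has exactly one
   representative there.  The real numbers below carry the Euclidean topology and metric of the
   ambient type; the metric of R/Z enters only through torus_norm. *)

definition torus :: "real set" where
  "torus = {0..<1}"

(* The trace on {0..<1} of the Borel sets of the real line corresponds to the Borel sets of R/Z. *)
definition torus_measure :: "real measure" where
  "torus_measure = restrict_space lborel torus"

(* Defined for every real representative, so it applies to differences of points of torus,
   which range over (-1, 1). *)
definition torus_norm :: "real \<Rightarrow> real" where
  "torus_norm x = infdist x \<int>"

(* Only the values r N and w n with positive index matter: N = 0 can be avoided by
   enlarging N0. *)
definition uniform_approx_set :: "(nat \<Rightarrow> real) \<Rightarrow> (nat \<Rightarrow> real) \<Rightarrow> real set" where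
  "uniform_approx_set r w =
     {y \<in> torus. \<exists>N0. \<forall>N\<ge>N0. \<exists>n\<in>{1..N}. torus_norm (w n - y) < r N}"

lemma space_torus_measure [simp]: "space torus_measure = torus"
  by (simp add: torus_measure_def space_restrict_space)

lemma prob_space_torus_measure: "prob_space torus_measure"
  by (rule prob_spaceI)
    (simp add: torus_measure_def torus_def space_restrict_space emeasure_restrict_space)

lemma torus_norm_eq: "torus_norm x = \<bar>x - of_int (round x)\<bar>"
proof (rule antisym)
  show "torus_norm x \<le> \<bar>x - of_int (round x)\<bar>"
    unfolding torus_norm_def dist_real_def [symmetric] by (rule infdist_le) simp
  show "\<bar>x - of_int (round x)\<bar> \<le> torus_norm x"
  proof -
    have ne: "(\<int> :: real set) \<noteq> {}"
      using Ints_0 by blast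
    show ?thesis
      unfolding torus_norm_def infdist_notempty [OF ne]
    proof (rule cINF_greatest [OF ne])
      fix z :: real
      assume "z \<in> \<int>"
      then obtain k where "z = of_int k"
        by (auto elim: Ints_cases)
      then show "\<bar>x - of_int (round x)\<bar> \<le> dist x z"
        using round_diff_minimal [of x k] by (simp add: dist_real_def)
    qed
  qed
qed

end

theory Submission
  imports Defs
begin

text \<open>
  The points \<open>\<omega> k\<close> always belong to the set, because the distance \<open>0\<close> is smaller than every
  radius. For the converse, fix \<open>y\<close> in the set and follow the point among the first \<open>N\<close> that is
  closest to \<open>y\<close>, which for large \<open>N\<close> has distance less than \<open>r N\<close> to \<open>y\<close>. As \<open>N\<close> grows to \<open>N + 1\<close>,
  this closest point can change only if the new point \<open>N + 1\<close> is even closer to \<open>y\<close>; both the old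
  and the new closest point then have distance less than \<open>r N\<close> to \<open>y\<close>, so the new point lies
  within \<open>2 * r N\<close> of one of its predecessors. A collision of this kind has
  probability \<open>O(N * r N)\<close>: there are \<open>N\<close> predecessors, and conditionally on a predecessor the new
  point is uniform. By Borel--Cantelli almost surely only finitely many collisions occur, so from
  some time on one fixed \<open>\<omega> m\<close> stays closest to \<open>y\<close>. Its distance to \<open>y\<close> is below \<open>r N\<close> for all
  large \<open>N\<close>, and \<open>r\<close> tends to \<open>0\<close>, hence \<open>y = \<omega> m\<close>.

  What makes the summability of \<open>n * r n\<close> enough is that only the newest point is compared
  with the earlier ones: a bound over all pairs of indices up to \<open>N\<close> would cost \<open>N\<^sup>2 * r N\<close>.
\<close>

lemma torus_norm_le: "torus_norm x \<le> \<bar>x - of_int k\<bar>"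
  unfolding torus_norm_def dist_real_def [symmetric] by (rule infdist_le) simp

lemma torus_norm_0 [simp]: "torus_norm 0 = 0"
  by (simp add: torus_norm_eq)

lemma torus_norm_triangle: "torus_norm (u - v) \<le> torus_norm (u - y) + torus_norm (v - y)"
proof -
  have "torus_norm (u - v) \<le> \<bar>(u - v) - of_int (round (u - y) - round (v - y))\<bar>"
    by (rule torus_norm_le)
  also have "\<dots> \<le> torus_norm (u - y) + torus_norm (v - y)"
    unfolding torus_norm_eq by simp
  finally show ?thesis .
qed

lemma torus_norm_diff_eq_0D:
  assumes "u \<in> torus" "v \<in> torus" "torus_norm (u - v) = 0"
  shows "u = v"
proof -
  have k: "u - v = of_int (round (u - v))"
    using assms(3) by (simp add: torus_norm_eq)
  moreover have "\<bar>u - v\<bar> < 1"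
    using assms(1,2) by (auto simp: torus_def)
  ultimately have "\<bar>round (u - v)\<bar> < 1"
    by linarith
  with k show ?thesis
    by simp
qed

lemma measurable_torus_norm [measurable]: "torus_norm \<in> borel_measurable borel"
  unfolding torus_norm_def
  by (intro borel_measurable_continuous_onI continuous_on_infdist continuous_on_id)

text \<open>
  The closest point among the first \<open>K\<close> remains closest to \<open>y\<close> forever: a strictly closer newcomer
  would, by the triangle inequality, violate the separation hypothesis.
\<close>

lemma uniform_approx_set_eq_range_of_separated:
  assumes torus: "\<And>k. k \<ge> 1 \<Longrightarrow> w k \<in> torus"
    and pos: "\<And>n. n \<ge> 1 \<Longrightarrow> r n > 0"
    and lim: "r \<longlonglongrightarrow> 0"
    and sep: "eventually (\<lambda>N. \<forall>m\<in>{1..N}. 2 * r N \<le> torus_norm (w (Suc N) - w m)) sequentially"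
  shows "uniform_approx_set r w = {w k | k. k \<ge> 1}"
proof (intro equalityI subsetI)
  fix y assume "y \<in> {w k | k. k \<ge> 1}"
  then obtain k where k: "k \<ge> 1" "y = w k"
    by blast
  have "\<exists>n\<in>{1..N}. torus_norm (w n - y) < r N" if "N \<ge> k" for N
    using that k pos [of N] by (intro bexI [of _ k]) auto
  with k torus show "y \<in> uniform_approx_set r w"
    unfolding uniform_approx_set_def by blast
next
  fix y assume "y \<in> uniform_approx_set r w"
  then obtain N0 where y: "y \<in> torus"
    and N0: "\<And>N. N \<ge> N0 \<Longrightarrow> \<exists>n\<in>{1..N}. torus_norm (w n - y) < r N"
    unfolding uniform_approx_set_def by blast
  obtain N1 where N1: "\<And>N m. N \<ge> N1 \<Longrightarrow> m \<in> {1..N} \<Longrightarrow> 2 * r N \<le> torus_norm (w (Suc N) - w m)"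
    using sep unfolding eventually_sequentially by blast
  define K where "K = max (max N0 N1) 1"
  define d where "d n = torus_norm (w n - y)" for n
  obtain m where m: "m \<in> {1..K}" and m_min: "\<And>n. n \<in> {1..K} \<Longrightarrow> d m \<le> d n"
    using arg_min_if_finite [of "{1..K}" d] unfolding K_def
    by (metis (full_types) atLeastAtMost_iff finite_atLeastAtMost empty_iff linorder_not_less
        max.cobounded2 order_refl)
  have closest: "\<forall>n\<in>{1..N}. d m \<le> d n" if "N \<ge> K" for N
    using that
  proof (induction N rule: dec_induct)
    case base
    then show ?case using m_min by blast
  next
    case (step N)
    have "d m < r N"
      using N0 [of N] step unfolding K_def d_def by fastforce
    moreover have "2 * r N \<le> torus_norm (w (Suc N) - w m)"
      using N1 [of N m] m step unfolding K_def by auto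
    moreover have "torus_norm (w (Suc N) - w m) \<le> d (Suc N) + d m"
      unfolding d_def by (rule torus_norm_triangle)
    ultimately have "d m \<le> d (Suc N)"
      by linarith
    with step show ?case
      by (auto simp: le_Suc_eq)
  qed
  have "d m \<le> r N" if "N \<ge> K" for N
    using N0 [of N] closest [OF that] that unfolding K_def d_def by fastforce
  then have "d m \<le> 0"
    by (intro LIMSEQ_le_const [OF lim]) blast
  then have "torus_norm (w m - y) = 0"
    unfolding d_def by (simp add: torus_norm_eq)
  with m y torus have "y = w m"
    using torus_norm_diff_eq_0D [of "w m" y] by auto
  with m show "y \<in> {w k | k. k \<ge> 1}"
    by auto
qed

text \<open>
  Differences of points of the fundamental domain lie in \<open>(-1, 1)\<close>, so a ball of the torus is
  covered by three intervals of the line. The resulting constant \<open>6\<close> instead of the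
  sharp \<open>2\<close> is harmless for a summability argument.
\<close>

lemma emeasure_torus_ball_le:
  assumes a: "a \<in> torus" and s: "s \<ge> 0"
  shows "emeasure torus_measure {z \<in> torus. torus_norm (z - a) < s} \<le> ennreal (6 * s)"
proof -
  define I where "I k = {a + of_int k - s <..< a + of_int k + s}" for k :: int
  have sub: "{z \<in> torus. torus_norm (z - a) < s} \<subseteq> (\<Union>k\<in>{-1, 0, 1}. I k)"
  proof
    fix z assume z: "z \<in> {z \<in> torus. torus_norm (z - a) < s}"
    define k where "k = round (z - a)"
    have "-1 < z - a" "z - a < 1"
      using z a by (auto simp: torus_def)
    then have "k \<in> {-1, 0, 1}"
      using of_int_round_abs_le [of "z - a"] unfolding k_def abs_le_iff by auto
    moreover have "z \<in> I k"
      using z unfolding I_def k_def torus_norm_eq by (auto simp: abs_less_iff)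
    ultimately show "z \<in> (\<Union>k\<in>{-1, 0, 1}. I k)"
      by blast
  qed
  have "emeasure torus_measure {z \<in> torus. torus_norm (z - a) < s}
      = emeasure lborel {z \<in> torus. torus_norm (z - a) < s}"
    unfolding torus_measure_def by (rule emeasure_restrict_space) (auto simp: torus_def)
  also have "\<dots> \<le> emeasure lborel (\<Union>k\<in>{-1, 0, 1}. I k)"
    by (rule emeasure_mono [OF sub]) (auto simp: I_def)
  also have "\<dots> \<le> (\<Sum>k\<in>{-1, 0, 1}. emeasure lborel (I k))"
    by (rule emeasure_subadditive_finite) (auto simp: I_def)
  also have "\<dots> = ennreal (6 * s)"
    using s ennreal_mult [of 3 "2 * s"] by (simp add: I_def)
  finally show ?thesis .
qed

lemma (in prob_space) indep_vars_imp_indep_var: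
  assumes "indep_vars M' X I" "i \<in> I" "j \<in> I" "i \<noteq> j"
  shows "indep_var (M' i) (X i) (M' j) (X j)"
proof -
  have "indep_var (M' i) ((\<lambda>f. f i) \<circ> (\<lambda>x. restrict (\<lambda>k. X k x) {i}))
      (M' j) ((\<lambda>f. f j) \<circ> (\<lambda>x. restrict (\<lambda>k. X k x) {j}))"
    using assms by (intro indep_var_compose [OF indep_var_restrict [OF assms(1)]]) auto
  then show ?thesis
    by (simp add: comp_def)
qed

text \<open>
  By independence the pair has the product distribution, and integrating over the first coordinate
  leaves the measure of a ball of radius \<open>s\<close>, whatever its centre.
\<close>

lemma (in prob_space) prob_torus_norm_diff_less_le:
  assumes indep: "indep_var torus_measure X torus_measure Y"
    and X: "distr M torus_measure X = torus_measure"
    and Y: "distr M torus_measure Y = torus_measure"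
    and s: "s \<ge> 0"
  shows "{x \<in> space M. torus_norm (Y x - X x) < s} \<in> events"
    and "prob {x \<in> space M. torus_norm (Y x - X x) < s} \<le> 6 * s"
proof -
  interpret T: prob_space torus_measure
    by (rule prob_space_torus_measure)
  have [measurable]: "X \<in> measurable M torus_measure" "Y \<in> measurable M torus_measure"
    using indep by (auto dest: indep_var_rv1 indep_var_rv2)
  have [measurable]: "(\<lambda>z. z) \<in> borel_measurable torus_measure"
    unfolding torus_measure_def by (intro measurable_restrict_space1) simp
  define B where "B = {p \<in> space (torus_measure \<Otimes>\<^sub>M torus_measure). torus_norm (snd p - fst p) < s}"
  have [measurable]: "fst \<in> borel_measurable (torus_measure \<Otimes>\<^sub>M torus_measure)"
    "snd \<in> borel_measurable (torus_measure \<Otimes>\<^sub>M torus_measure)"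
    by (auto intro: measurable_compose [OF measurable_fst] measurable_compose [OF measurable_snd])
  have B: "B \<in> sets (torus_measure \<Otimes>\<^sub>M torus_measure)"
    unfolding B_def by measurable
  have joint: "distr M (torus_measure \<Otimes>\<^sub>M torus_measure) (\<lambda>x. (X x, Y x))
      = torus_measure \<Otimes>\<^sub>M torus_measure"
    using indep X Y unfolding indep_var_distribution_eq by simp
  have eq: "{x \<in> space M. torus_norm (Y x - X x) < s} = (\<lambda>x. (X x, Y x)) -` B \<inter> space M"
    using measurable_space [of X M torus_measure] measurable_space [of Y M torus_measure]
    by (auto simp: B_def space_pair_measure)
  show "{x \<in> space M. torus_norm (Y x - X x) < s} \<in> events"
    unfolding eq by (rule measurable_sets [OF _ B]) measurable
  have "emeasure M {x \<in> space M. torus_norm (Y x - X x) < s}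
      = emeasure (distr M (torus_measure \<Otimes>\<^sub>M torus_measure) (\<lambda>x. (X x, Y x))) B"
    unfolding eq by (rule emeasure_distr [symmetric, OF _ B]) measurable
  also have "\<dots> = (\<integral>\<^sup>+a. emeasure torus_measure (Pair a -` B) \<partial>torus_measure)"
    unfolding joint by (rule T.emeasure_pair_measure_alt [OF B])
  also have "\<dots> \<le> (\<integral>\<^sup>+a. ennreal (6 * s) \<partial>torus_measure)"
  proof (rule nn_integral_mono)
    fix a assume "a \<in> space torus_measure"
    then have "a \<in> torus" "Pair a -` B = {z \<in> torus. torus_norm (z - a) < s}"
      by (auto simp: B_def space_pair_measure)
    then show "emeasure torus_measure (Pair a -` B) \<le> ennreal (6 * s)"
      using emeasure_torus_ball_le [OF _ s] by simp
  qed
  also have "\<dots> = ennreal (6 * s)"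
    by (simp only: nn_integral_const T.emeasure_space_1 mult_1_right)
  finally show "prob {x \<in> space M. torus_norm (Y x - X x) < s} \<le> 6 * s"
    using s by (simp add: emeasure_eq_measure)
qed

theorem theorem3:
  fixes M :: "'a measure" and \<omega> :: "nat \<Rightarrow> 'a \<Rightarrow> real" and r :: "nat \<Rightarrow> real"
  assumes "prob_space M"
    and "\<And>n. n \<ge> 1 \<Longrightarrow> r n > 0"
    and "prob_space.indep_vars M (\<lambda>_. torus_measure) \<omega> {1..}"
    and "\<And>n. n \<ge> 1 \<Longrightarrow> distr M torus_measure (\<omega> n) = torus_measure"
    and "summable (\<lambda>n. real n * r n)"
  shows "AE x in M. uniform_approx_set r (\<lambda>n. \<omega> n x) = {\<omega> k x | k. k \<ge> 1}"
proof -
  interpret prob_space M by fact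
  note pos = assms(2) and indep = assms(3) and unif = assms(4) and summ = assms(5)
  have lim: "r \<longlonglongrightarrow> 0"
  proof (rule tendsto_sandwich [OF _ _ tendsto_const summable_LIMSEQ_zero [OF summ]])
    show "\<forall>\<^sub>F n in sequentially. 0 \<le> r n"
      using pos by (intro eventually_sequentiallyI [of 1]) (simp add: less_imp_le)
    show "\<forall>\<^sub>F n in sequentially. r n \<le> real n * r n"
      using pos by (intro eventually_sequentiallyI [of 1]) simp
  qed
  define C where "C N m = {x \<in> space M. torus_norm (\<omega> (Suc N) x - \<omega> m x) < 2 * r N}" for N m
  have C: "C N m \<in> events" "prob (C N m) \<le> 6 * (2 * r N)" if "m \<in> {1..N}" for N m
  proof -
    have "indep_var torus_measure (\<omega> m) torus_measure (\<omega> (Suc N))"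
      using indep_vars_imp_indep_var [OF indep, of m "Suc N"] that by simp
    moreover have "distr M torus_measure (\<omega> m) = torus_measure"
        "distr M torus_measure (\<omega> (Suc N)) = torus_measure" "2 * r N \<ge> 0"
      using unif pos [of N] that by simp_all
    ultimately show "C N m \<in> events" "prob (C N m) \<le> 6 * (2 * r N)"
      unfolding C_def by (rule prob_torus_norm_diff_less_le)+
  qed
  define A where "A N = (\<Union>m\<in>{1..N}. C N m)" for N
  have A: "A N \<in> events" for N
    unfolding A_def using C(1) by (intro sets.finite_UN) auto
  have "prob (A N) \<le> 12 * (real N * r N)" for N
  proof -
    have "prob (A N) \<le> (\<Sum>m\<in>{1..N}. prob (C N m))"
      unfolding A_def using C(1) by (intro finite_measure_subadditive_finite) auto
    also have "\<dots> \<le> (\<Sum>m\<in>{1..N}. 12 * r N)"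
      using C(2) by (intro sum_mono) simp
    finally show ?thesis by simp
  qed
  then have "summable (\<lambda>N. prob (A N))"
    by (intro summable_comparison_test' [OF summable_mult [OF summ, of 12]]) simp
  then have "AE x in M. eventually (\<lambda>N. x \<in> space M - A N) sequentially"
    by (intro borel_cantelli_AE1 A) (simp_all add: emeasure_eq_measure)
  then show ?thesis
  proof eventually_elim
    case (elim x)
    then have x: "x \<in> space M"
      by (auto simp: eventually_sequentially)
    show ?case
    proof (rule uniform_approx_set_eq_range_of_separated [OF _ pos lim])
      show "\<omega> k x \<in> torus" if "k \<ge> 1" for k
        using indep that measurable_space [OF _ x, of "\<omega> k" torus_measure]
        by (auto simp: indep_vars_def)
      show "\<forall>\<^sub>F N in sequentially. \<forall>m\<in>{1..N}. 2 * r N \<le> torus_norm (\<omega> (Suc N) x - \<omega> m x)"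
        using elim by eventually_elim (auto simp: A_def C_def not_less)
    qed
  qed
qed

end
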